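(* Let $d,m,T\ge1$, $U=(u_1,\dots,u_m)\in(\mathbb{S}^{d-1})^m$, $\Gamma\in\mathbb{R}^{T\times m}$, and $H_t=\Psi_t(U,\Gamma)$ for $t=1,\dots,T$. Assume that the restricted differential $J_{\mathrm{res}}(U,\Gamma)$ is injective and let $\kappa>0$ be its smallest singular value. For every constant $C_0>0$ there exist a constant $C>0$ depending only on $C_0$ (not on $\eta$ or $\kappa$), a neighborhood $\mathcal{N}$ of $(U,\Gamma)$ in $(\mathbb{S}^{d-1})^m\times\mathbb{R}^{T\times m}$, and $\eta_0>0$ such that the following holds. Let $E_1,\dots,E_T$ be symmetric $d\times d$ real matrices, let $\widehat H_t=H_t+E_t$, and suppose that $$\eta=\Big(\sum_{t=1}^T\|E_t\|_F^2\Big)^{1/2}\le\eta_0 .$$ Let $(\widehat U,\widehat\Gamma)\in\mathcal{N}$ be a local minimizer over $(\mathbb{S}^{d-1})^m\times\mathbb{R}^{T\times m}$ of the least-squares objective $(U',\Gamma')\mapsto\sum_{t=1}^T\|\widehat H_t-\Psi_t(U',\Gamma')\|_F^2$ whose stacked residual satisfies $\big(\sum_{t=1}^T\|\widehat H_t-\Psi_t(\widehat U,\widehat\Gamma)\|_F^2\big)^{1/2}\le C_0\,\eta$. Then $$\operatorname{dist}_{\pm,\pi}\big((\widehat U,\widehat\Gamma),(U,\Gamma)\big)\le C\,\frac{\eta}{\kappa},$$ and consequently $$\operatorname{DirRec}(\widehat U,U)\ge 1-C\,\frac{\eta^2}{\kappa^2}.$$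
   Context: $\mathbb{S}^{d-1}=\{u\in\mathbb{R}^d:\|u\|_2=1\}$. For $U\in(\mathbb{S}^{d-1})^m$, $\Gamma=[\gamma_{t,j}]\in\mathbb{R}^{T\times m}$, $\Psi_t(U,\Gamma)=\sum_{j=1}^m\gamma_{t,j}u_ju_j^\top$ and $\Psi=(\Psi_1,\dots,\Psi_T)$. $J_{\mathrm{res}}(U,\Gamma)$ is the differential of $\Psi$ at $(U,\Gamma)$ restricted to $(\dot U,\dot\Gamma)$ with $u_j^\top\dot u_j=0$ for all $j$ and $\dot\Gamma\in\mathbb{R}^{T\times m}$ arbitrary; its value has $t$-th entry $\sum_j[\dot\gamma_{t,j}u_ju_j^\top+\gamma_{t,j}(\dot u_ju_j^\top+u_j\dot u_j^\top)]$. Singular values are taken with respect to the Euclidean norm $(\sum_j\|\dot u_j\|_2^2+\|\dot\Gamma\|_F^2)^{1/2}$ on the tangent space and the stacked Frobenius norm $(\sum_t\|\cdot\|_F^2)^{1/2}$ on $T$-tuples of matrices; the smallest singular value is the minimum of $\|J_{\mathrm{res}}\xi\|$ over unit tangent vectors $\xi$. The symmetry-aware factor distance is $$\operatorname{dist}_{\pm,\pi}^2\big((\widehat U,\widehat\Gamma),(U,\Gamma)\big)=\min_{\pi\in S_m,\ \sigma\in\{\pm1\}^m}\Big[\sum_{j=1}^m\|\widehat u_{\pi(j)}-\sigma_ju_j\|_2^2+\sum_{j=1}^m\|\widehat\Gamma_{\cdot,\pi(j)}-\Gamma_{\cdot,j}\|_2^2\Big].$$ The matched direction-recovery score is $$\operatorname{DirRec}(\widehat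 U,U)=\max_{\pi\in S_m}\frac1m\sum_{j=1}^m|\langle\widehat u_{\pi(j)},u_j\rangle|.$$ Here $S_m$ is the symmetric group on $\{1,\dots,m\}$. *)

theory Defs
  imports "HOL-Analysis.Analysis" "HOL-Combinatorics.Permutations"
begin

text \<open>
  The dimensions \<open>d\<close>, \<open>m\<close>, \<open>T\<close> are natural numbers rather than index types, because the
  constant of the main result has to be uniform in them.  A vector of \<open>\<real>\<^sup>d\<close> is a function
  \<open>nat \<Rightarrow> real\<close> with indices in \<open>{..<d}\<close>; \<open>U j\<close> is the direction \<open>u\<^sub>j\<close> and \<open>\<Gamma> t j\<close> is
  \<open>\<gamma>\<^sub>t\<^sub>,\<^sub>j\<close>.  All indices start at 0.
\<close>

type_synonym rmat = "nat \<Rightarrow> nat \<Rightarrow> real"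
type_synonym factors = "rmat \<times> rmat"

definition ip :: "nat \<Rightarrow> (nat \<Rightarrow> real) \<Rightarrow> (nat \<Rightarrow> real) \<Rightarrow> real" where
  "ip d x y = (\<Sum>k<d. x k * y k)"

definition vnorm :: "nat \<Rightarrow> (nat \<Rightarrow> real) \<Rightarrow> real" where
  "vnorm d x = L2_set x {..<d}"

definition frob :: "nat \<Rightarrow> nat \<Rightarrow> rmat \<Rightarrow> real" where
  "frob p q A = L2_set (\<lambda>(a, b). A a b) ({..<p} \<times> {..<q})"

definition stacked_frob :: "nat \<Rightarrow> nat \<Rightarrow> (nat \<Rightarrow> rmat) \<Rightarrow> real" where
  "stacked_frob d T M = L2_set (\<lambda>t. frob d d (M t)) {..<T}"

text \<open>
  Entries outside the index ranges are required to be 0, so that the following set of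
  functions is a faithful copy of the vector space of \<open>p \<times> q\<close> matrices, and the subspace
  topology it inherits from the product topology on \<open>nat \<Rightarrow> nat \<Rightarrow> real\<close> is the Euclidean one.
\<close>

definition mats :: "nat \<Rightarrow> nat \<Rightarrow> rmat set" where
  "mats p q = {A. \<forall>a b. \<not> (a < p \<and> b < q) \<longrightarrow> A a b = 0}"

definition param_space :: "nat \<Rightarrow> nat \<Rightarrow> nat \<Rightarrow> factors set" where
  "param_space d m T =
     {(U, \<Gamma>). U \<in> mats m d \<and> (\<forall>j<m. vnorm d (U j) = 1) \<and> \<Gamma> \<in> mats T m}"

definition Psi :: "nat \<Rightarrow> factors \<Rightarrow> nat \<Rightarrow> rmat" where
  "Psi m = (\<lambda>(U, \<Gamma>) t a b. \<Sum>j<m. \<Gamma> t j * (U j a * U j b))"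

definition tangent_space :: "nat \<Rightarrow> nat \<Rightarrow> nat \<Rightarrow> factors \<Rightarrow> factors set" where
  "tangent_space d m T = (\<lambda>(U, \<Gamma>).
     {(V, G). V \<in> mats m d \<and> (\<forall>j<m. ip d (U j) (V j) = 0) \<and> G \<in> mats T m})"

definition tangent_norm :: "nat \<Rightarrow> nat \<Rightarrow> nat \<Rightarrow> factors \<Rightarrow> real" where
  "tangent_norm d m T = (\<lambda>(V, G). sqrt ((\<Sum>j<m. (vnorm d (V j))\<^sup>2) + (frob T m G)\<^sup>2))"

definition J_res :: "nat \<Rightarrow> factors \<Rightarrow> factors \<Rightarrow> nat \<Rightarrow> rmat" where
  "J_res m = (\<lambda>(U, \<Gamma>) (V, G) t a b.
     \<Sum>j<m. G t j * (U j a * U j b) + \<Gamma> t j * (V j a * U j b + U j a * V j b))"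

lemma J_res_is_derivative_of_Psi:
  "((\<lambda>s. Psi m (\<lambda>j k. U j k + s * V j k, \<lambda>t j. \<Gamma> t j + s * G t j) t a b)
      has_real_derivative J_res m (U, \<Gamma>) (V, G) t a b) (at 0)"
  unfolding Psi_def J_res_def prod.case
  by (rule DERIV_sum) (auto intro!: derivative_eq_intros simp: algebra_simps)

text \<open>
  The infimum below is a minimum whenever \<open>m, T \<ge> 1\<close> and \<open>X\<close> lies in the parameter space:
  the unit sphere of the tangent space is then nonempty and compact.
\<close>

definition smallest_singular_value :: "nat \<Rightarrow> nat \<Rightarrow> nat \<Rightarrow> factors \<Rightarrow> real" where
  "smallest_singular_value d m T X =
     Inf {stacked_frob d T (J_res m X \<xi>) | \<xi>. \<xi> \<in> tangent_space d m T X \<and> tangent_norm d m T \<xi> = 1}"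

definition residual :: "nat \<Rightarrow> (nat \<Rightarrow> rmat) \<Rightarrow> factors \<Rightarrow> nat \<Rightarrow> rmat" where
  "residual m H X = (\<lambda>t a b. H t a b - Psi m X t a b)"

definition objective :: "nat \<Rightarrow> nat \<Rightarrow> nat \<Rightarrow> (nat \<Rightarrow> rmat) \<Rightarrow> factors \<Rightarrow> real" where
  "objective d m T H X = (\<Sum>t<T. (frob d d (residual m H X t))\<^sup>2)"

definition local_minimizer_on :: "'a::topological_space set \<Rightarrow> ('a \<Rightarrow> real) \<Rightarrow> 'a \<Rightarrow> bool" where
  "local_minimizer_on S f x \<longleftrightarrow> x \<in> S \<and> (\<forall>\<^sub>F y in at x within S. f x \<le> f y)"

definition dist_pm_pi :: "nat \<Rightarrow> nat \<Rightarrow> nat \<Rightarrow> factors \<Rightarrow> factors \<Rightarrow> real" where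
  "dist_pm_pi d m T = (\<lambda>(Uh, \<Gamma>h) (U, \<Gamma>). sqrt (Min
     ((\<lambda>(\<pi>, \<sigma>).
         (\<Sum>j<m. (vnorm d (\<lambda>k. Uh (\<pi> j) k - \<sigma> j * U j k))\<^sup>2) +
         (\<Sum>j<m. (vnorm T (\<lambda>t. \<Gamma>h t (\<pi> j) - \<Gamma> t j))\<^sup>2)) `
      ({\<pi>. \<pi> permutes {..<m}} \<times> ({..<m} \<rightarrow>\<^sub>E {-1, 1 :: real})))))"

definition DirRec :: "nat \<Rightarrow> nat \<Rightarrow> rmat \<Rightarrow> rmat \<Rightarrow> real" where
  "DirRec d m Uh U =
     Max ((\<lambda>\<pi>. 1 / real m * (\<Sum>j<m. \<bar>ip d (Uh (\<pi> j)) (U j)\<bar>)) ` {\<pi>. \<pi> permutes {..<m}})"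

end

theory Submission
  imports Defs
begin

text \<open>
  Write \<open>(\<delta>, G)\<close> for the difference between the estimate and the truth and \<open>D\<close> for its norm.
  Since \<open>u\<^sub>j\<close> and \<open>u\<^sub>j + \<delta>\<^sub>j\<close> are both unit vectors, \<open>\<langle>u\<^sub>j, \<delta>\<^sub>j\<rangle> = - \<parallel>\<delta>\<^sub>j\<parallel>\<^sup>2 / 2\<close>, so the
  projection of \<open>(\<delta>, G)\<close> to the tangent space differs from it only at second order.
  Expanding the cubic \<open>\<Psi>\<close> therefore gives \<open>\<parallel>\<Delta>\<Psi>\<parallel> \<ge> \<kappa> (3/4) D - K D\<^sup>2 \<ge> \<kappa> D / 2\<close> for small \<open>D\<close>,
  while \<open>\<parallel>\<Delta>\<Psi>\<parallel> \<le> (C\<^sub>0 + 1) \<eta>\<close> by the triangle inequality.  The identity permutation and trivial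
  signs bound the factor distance by \<open>D\<close>, and \<open>\<langle>u\<^sub>j, u\<^sub>j + \<delta>\<^sub>j\<rangle> = 1 - \<parallel>\<delta>\<^sub>j\<parallel>\<^sup>2 / 2\<close> bounds the
  recovery score.  Positivity of \<open>\<kappa>\<close> is compactness of the unit sphere of the tangent space.
\<close>

section \<open>Euclidean norms of vectors, matrices and stacks of matrices\<close>

lemma vnorm_square: "(vnorm d x)\<^sup>2 = (\<Sum>k<d. (x k)\<^sup>2)"
  by (simp add: vnorm_def L2_set_def sum_nonneg)

lemma vnorm_nonneg: "0 \<le> vnorm d x"
  by (simp add: vnorm_def)

lemma abs_le_vnorm: "k < d \<Longrightarrow> \<bar>x k\<bar> \<le> vnorm d x"
  using member_le_L2_set[of "{..<d}" k "\<lambda>i. \<bar>x i\<bar>"]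
  by (simp add: vnorm_def L2_set_def)

lemma vnorm_square_ip: "(vnorm d x)\<^sup>2 = ip d x x"
  unfolding vnorm_square ip_def by (simp add: power2_eq_square)

lemma frob_square: "(frob p q A)\<^sup>2 = (\<Sum>a<p. \<Sum>b<q. (A a b)\<^sup>2)"
  by (simp add: frob_def L2_set_def sum_nonneg sum.cartesian_product split_def)

text \<open>Flattening the nested norms to one \<open>L2_set\<close> over index triples makes the
  triangle inequality, homogeneity and definiteness direct instances of facts on
  \<open>L2_set\<close>.\<close>

lemma stacked_frob_eq_L2_set:
  "stacked_frob d T M = L2_set (\<lambda>(t, a, b). M t a b) ({..<T} \<times> {..<d} \<times> {..<d})"
proof -
  have "(\<Sum>t<T. (frob d d (M t))\<^sup>2)
      = (\<Sum>x\<in>{..<T} \<times> {..<d} \<times> {..<d}. (case x of (t, a, b) \<Rightarrow> M t a b)\<^sup>2)"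
    by (simp add: frob_square sum.cartesian_product split_def)
  then show ?thesis
    by (simp add: stacked_frob_def L2_set_def)
qed

lemma stacked_frob_nonneg: "0 \<le> stacked_frob d T M"
  by (simp add: stacked_frob_def)

lemma stacked_frob_triangle:
  "stacked_frob d T (\<lambda>t a b. M t a b + N t a b) \<le> stacked_frob d T M + stacked_frob d T N"
  using L2_set_triangle_ineq[of "\<lambda>(t, a, b). M t a b" "\<lambda>(t, a, b). N t a b"]
  by (simp add: stacked_frob_eq_L2_set split_def)

lemma stacked_frob_triangle_diff:
  "stacked_frob d T (\<lambda>t a b. M t a b - N t a b) \<le> stacked_frob d T M + stacked_frob d T N"
proof -
  have "stacked_frob d T (\<lambda>t a b. - N t a b) = stacked_frob d T N"
    by (simp add: stacked_frob_eq_L2_set L2_set_def split_def)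
  then show ?thesis
    using stacked_frob_triangle[of d T M "\<lambda>t a b. - N t a b"] by simp
qed

lemma stacked_frob_scale:
  assumes "0 \<le> c"
  shows "stacked_frob d T (\<lambda>t a b. c * M t a b) = c * stacked_frob d T M"
  using L2_set_right_distrib[OF assms, of "\<lambda>(t, a, b). M t a b"]
  by (simp add: stacked_frob_eq_L2_set split_def)

text \<open>The Euclidean norm is at most the sum of absolute values. The crude factor is harmless:
  it will shrink only the neighbourhood, never enter the final constant.\<close>

lemma stacked_frob_le:
  assumes "\<And>t a b. t < T \<Longrightarrow> a < d \<Longrightarrow> b < d \<Longrightarrow> \<bar>M t a b\<bar> \<le> c"
  shows "stacked_frob d T M \<le> real (T * (d * d)) * c"
proof -
  have "stacked_frob d T M \<le> (\<Sum>x\<in>{..<T} \<times> {..<d} \<times> {..<d}. \<bar>case x of (t, a, b) \<Rightarrow> M t a b\<bar>)"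
    unfolding stacked_frob_eq_L2_set by (rule L2_set_le_sum_abs)
  also have "\<dots> \<le> (\<Sum>x\<in>{..<T} \<times> {..<d} \<times> {..<d}. c)"
    using assms by (intro sum_mono) auto
  finally show ?thesis by (simp add: mult.assoc)
qed

lemma stacked_frob_eq_0_iff:
  "stacked_frob d T M = 0 \<longleftrightarrow> (\<forall>t<T. \<forall>a<d. \<forall>b<d. M t a b = 0)"
  by (auto simp: stacked_frob_eq_L2_set L2_set_eq_0_iff)

section \<open>The tangent norm and the singular value inequality\<close>

lemma tangent_norm_square:
  "(tangent_norm d m T (V, G))\<^sup>2 = (\<Sum>j<m. (vnorm d (V j))\<^sup>2) + (frob T m G)\<^sup>2"
  by (simp add: tangent_norm_def sum_nonneg)

lemma tangent_norm_nonneg: "0 \<le> tangent_norm d m T \<xi>"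
  by (simp add: tangent_norm_def split_def sum_nonneg)

lemma tangent_norm_scale:
  assumes "0 \<le> c"
  shows "tangent_norm d m T (\<lambda>j k. c * V j k, \<lambda>t j. c * G t j) = c * tangent_norm d m T (V, G)"
proof (rule power2_eq_imp_eq)
  show "(tangent_norm d m T (\<lambda>j k. c * V j k, \<lambda>t j. c * G t j))\<^sup>2
      = (c * tangent_norm d m T (V, G))\<^sup>2"
    by (simp add: power_mult_distrib tangent_norm_square vnorm_square frob_square
        sum_distrib_left distrib_left)
qed (use assms in \<open>auto simp: tangent_norm_nonneg\<close>)

lemma vnorm_le_tangent_norm:
  assumes "j < m"
  shows "vnorm d (V j) \<le> tangent_norm d m T (V, G)"
proof (rule power2_le_imp_le)
  show "(vnorm d (V j))\<^sup>2 \<le> (tangent_norm d m T (V, G))\<^sup>2"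
    using member_le_sum[of j "{..<m}" "\<lambda>j. (vnorm d (V j))\<^sup>2"] assms
      zero_le_power2[of "frob T m G"]
    unfolding tangent_norm_square by (simp add: add_increasing2)
qed (rule tangent_norm_nonneg)

lemma abs_le_tangent_norm:
  assumes "t < T" "j < m"
  shows "\<bar>G t j\<bar> \<le> tangent_norm d m T (V, G)"
proof (rule power2_le_imp_le)
  have "(G t j)\<^sup>2 \<le> (\<Sum>j<m. (G t j)\<^sup>2)"
    using member_le_sum[of j "{..<m}" "\<lambda>j. (G t j)\<^sup>2"] assms by simp
  also have "\<dots> \<le> (\<Sum>t<T. \<Sum>j<m. (G t j)\<^sup>2)"
    using member_le_sum[of t "{..<T}" "\<lambda>t. \<Sum>j<m. (G t j)\<^sup>2"] assms by (simp add: sum_nonneg)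
  also have "\<dots> \<le> (tangent_norm d m T (V, G))\<^sup>2"
    by (simp add: tangent_norm_square frob_square sum_nonneg)
  finally show "\<bar>G t j\<bar>\<^sup>2 \<le> (tangent_norm d m T (V, G))\<^sup>2" by simp
qed (rule tangent_norm_nonneg)

lemma J_res_scale:
  "J_res m X (\<lambda>j k. c * V j k, \<lambda>t j. c * G t j) = (\<lambda>t a b. c * J_res m X (V, G) t a b)"
  by (cases X) (auto simp: J_res_def sum_distrib_left algebra_simps fun_eq_iff)

text \<open>By homogeneity a tangent vector of nonzero norm can be scaled to the unit sphere, where
  the infimum applies; for norm zero the left side vanishes.\<close>

lemma smallest_singular_value_le:
  assumes "\<xi> \<in> tangent_space d m T X"
  shows "smallest_singular_value d m T X * tangent_norm d m T \<xi> \<le> stacked_frob d T (J_res m X \<xi>)"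
proof -
  obtain V G where \<xi>: "\<xi> = (V, G)" by (cases \<xi>)
  define n where "n = tangent_norm d m T \<xi>"
  show ?thesis
  proof (cases "n = 0")
    case True
    then show ?thesis by (simp add: n_def stacked_frob_nonneg)
  next
    case False
    then have n: "0 < n" using tangent_norm_nonneg[of d m T \<xi>] by (simp add: n_def)
    define \<zeta> where "\<zeta> = (\<lambda>j k. (1/n) * V j k, \<lambda>t j. (1/n) * G t j)"
    have "\<zeta> \<in> tangent_space d m T X"
      using assms
      by (auto simp: tangent_space_def \<zeta>_def \<xi> mats_def ip_def sum_divide_distrib[symmetric])
    moreover have "tangent_norm d m T \<zeta> = 1"
      using n tangent_norm_scale[of "1/n" d m T V G] by (simp add: \<zeta>_def n_def \<xi>)
    ultimately have "smallest_singular_value d m T X \<le> stacked_frob d T (J_res m X \<zeta>)"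
      unfolding smallest_singular_value_def
      by (intro cInf_lower bdd_belowI[of _ 0]) (blast intro: stacked_frob_nonneg)+
    also have "\<dots> = stacked_frob d T (J_res m X \<xi>) / n"
      unfolding \<zeta>_def J_res_scale using n
      by (simp add: \<xi> stacked_frob_scale[of "1/n", simplified])
    finally show ?thesis using n by (simp add: n_def field_simps)
  qed
qed

section \<open>Compactness of the tangent unit sphere and positivity of the smallest singular
  value\<close>

text \<open>Tychonoff's theorem, moved from the abstract product topology to the type-class topology
  on functions.\<close>

lemma compact_PiE_UNIV:
  fixes S :: "'a \<Rightarrow> 'b::topological_space set"
  assumes "\<And>i. compact (S i)"
  shows "compact (\<Pi>\<^sub>E i\<in>UNIV. S i)"
proof -
  have "compactin (product_topology (\<lambda>i. euclidean) UNIV) (\<Pi>\<^sub>E i\<in>UNIV. S i)"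
    using assms by (auto simp: compactin_PiE)
  then show ?thesis by (simp add: euclidean_product_topology)
qed

text \<open>Zero padding turns this set into a full product: the interval from -1 to 1 at each index
  in range and the singleton of 0 elsewhere. Tychonoff is then applied once per index.\<close>

lemma compact_bounded_mats: "compact {A \<in> mats p q. \<forall>a b. \<bar>A a b\<bar> \<le> 1}"
proof -
  let ?S = "\<lambda>a b. if a < p \<and> b < q then {-1..1} else {0::real}"
  have "compact (\<Pi>\<^sub>E a\<in>UNIV. \<Pi>\<^sub>E b\<in>UNIV. ?S a b)"
    by (intro compact_PiE_UNIV) auto
  also have "(\<Pi>\<^sub>E a\<in>UNIV. \<Pi>\<^sub>E b\<in>UNIV. ?S a b) = {A \<in> mats p q. \<forall>a b. \<bar>A a b\<bar> \<le> 1}"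
  proof (intro equalityI subsetI)
    fix A assume "A \<in> (\<Pi>\<^sub>E a\<in>UNIV. \<Pi>\<^sub>E b\<in>UNIV. ?S a b)"
    then have A: "A a b \<in> ?S a b" for a b by (auto simp: PiE_UNIV_domain Pi_iff)
    have "\<bar>A a b\<bar> \<le> 1" for a b using A[of a b] by (auto split: if_splits)
    moreover have "A \<in> mats p q" using A by (force simp: mats_def split: if_splits)
    ultimately show "A \<in> {A \<in> mats p q. \<forall>a b. \<bar>A a b\<bar> \<le> 1}" by simp
  qed (auto simp: mats_def PiE_UNIV_domain Pi_iff abs_le_iff minus_le_iff)
  finally show ?thesis .
qed

lemma continuous_on_entry:
  "continuous_on S (\<lambda>Y::factors. fst Y a b)" "continuous_on S (\<lambda>Y::factors. snd Y a b)"
proof -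
  have ev: "continuous_on UNIV (\<lambda>A::rmat. A a b)"
    using continuous_on_product_then_coordinatewise[OF continuous_on_product_coordinates] .
  show "continuous_on S (\<lambda>Y::factors. fst Y a b)"
    by (rule continuous_on_compose2[OF ev continuous_on_fst[OF continuous_on_id]]) simp
  show "continuous_on S (\<lambda>Y::factors. snd Y a b)"
    by (rule continuous_on_compose2[OF ev continuous_on_snd[OF continuous_on_id]]) simp
qed

text \<open>Serves twice: with base point zero it is continuity of \<open>tangent_norm\<close>, and
  with base point \<open>(U, \<Gamma>)\<close> it makes norm balls around the truth open.\<close>

lemma continuous_on_tangent_norm_diff:
  "continuous_on S (\<lambda>Y. tangent_norm d m T (\<lambda>j k. fst Y j k - U j k, \<lambda>t j. snd Y t j - \<Gamma> t j))"
  unfolding tangent_norm_def prod.case vnorm_square frob_square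
  by (intro continuous_on_real_sqrt continuous_on_add continuous_on_sum continuous_on_power
      continuous_on_diff continuous_on_const continuous_on_entry)

text \<open>The norm of the image attains its minimum on the compact unit sphere of the tangent
  space, and injectivity forbids the value zero there.\<close>

lemma smallest_singular_value_pos:
  assumes m: "1 \<le> m" and T: "1 \<le> T" and X: "(U, \<Gamma>) \<in> param_space d m T"
    and inj: "inj_on (J_res m (U, \<Gamma>)) (tangent_space d m T (U, \<Gamma>))"
  shows "0 < smallest_singular_value d m T (U, \<Gamma>)"
proof -
  let ?X = "(U, \<Gamma>)"
  let ?f = "\<lambda>\<xi>. stacked_frob d T (J_res m ?X \<xi>)"
  let ?S = "{\<xi> \<in> tangent_space d m T ?X. tangent_norm d m T \<xi> = 1}"
  \<comment> \<open>The sphere \<open>?S\<close> is the compact box \<open>?K\<close> cut by the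
    closed conditions \<open>?L\<close>: unit norm bounds every entry by 1.\<close>
  let ?K = "{A \<in> mats m d. \<forall>a b. \<bar>A a b\<bar> \<le> 1} \<times> {A \<in> mats T m. \<forall>a b. \<bar>A a b\<bar> \<le> 1}"
  let ?L = "{\<xi>. \<forall>j<m. ip d (U j) (fst \<xi> j) = 0} \<inter> {\<xi>. tangent_norm d m T \<xi> = 1}"
  have "?S \<subseteq> ?K"
  proof
    fix \<xi> assume "\<xi> \<in> ?S"
    moreover obtain V G where \<xi>: "\<xi> = (V, G)" by (cases \<xi>)
    ultimately have V: "V \<in> mats m d" and G: "G \<in> mats T m" and n: "tangent_norm d m T (V, G) = 1"
      by (auto simp: tangent_space_def)
    have "\<bar>V j k\<bar> \<le> 1" for j k
    proof (cases "j < m \<and> k < d")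
      case True
      then show ?thesis
        using abs_le_vnorm[of k d "V j"] vnorm_le_tangent_norm[of j m d V T G] n by simp
    qed (use V in \<open>auto simp: mats_def\<close>)
    moreover have "\<bar>G t j\<bar> \<le> 1" for t j
    proof (cases "t < T \<and> j < m")
      case True
      then show ?thesis
        using abs_le_tangent_norm[of t T j m G d V] n by simp
    qed (use G in \<open>auto simp: mats_def\<close>)
    ultimately show "\<xi> \<in> ?K" using V G \<xi> by simp
  qed
  then have S_eq: "?S = ?K \<inter> ?L"
    by (auto simp: tangent_space_def)
  have tn: "continuous_on UNIV (tangent_norm d m T)"
    using continuous_on_tangent_norm_diff[of UNIV d m T "\<lambda>_ _. 0" "\<lambda>_ _. 0"] by simp
  have "closed {\<xi>::factors. \<forall>j<m. ip d (U j) (fst \<xi> j) = 0}"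
    unfolding ip_def
    by (intro closed_Collect_all closed_Collect_imp closed_Collect_eq open_Collect_const
        continuous_on_sum continuous_on_mult continuous_on_const continuous_on_entry)
  moreover have "closed {\<xi>. tangent_norm d m T \<xi> = 1}"
    by (intro closed_Collect_eq tn continuous_on_const)
  ultimately have "closed ?L" by (rule closed_Int)
  then have "compact ?S"
    unfolding S_eq by (intro compact_Int_closed compact_Times compact_bounded_mats)
  moreover have "?S \<noteq> {}"
  proof -
    \<comment> \<open>A matrix unit in the weights, with no motion of the directions, is a unit
      tangent vector; its index is in range because \<open>m\<close> and \<open>T\<close> are at
      least 1.\<close>
    let ?G = "\<lambda>t j. if t = 0 \<and> j = 0 then 1 else 0 :: real"
    have "(\<Sum>t<T. \<Sum>j<m. (?G t j)\<^sup>2) = (\<Sum>t<T. \<Sum>j<m. if t = 0 then (if j = 0 then 1 else 0) else 0)"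
      by (intro sum.cong) auto
    also have "\<dots> = (\<Sum>t<T. if t = 0 then 1 else 0)"
      using m by (intro sum.cong) auto
    also have "\<dots> = 1" using T by simp
    finally have "tangent_norm d m T (\<lambda>_ _. 0, ?G) = 1"
      by (simp add: tangent_norm_def vnorm_square frob_square)
    moreover have "(\<lambda>_ _. 0, ?G) \<in> tangent_space d m T ?X"
      using m T by (auto simp: tangent_space_def mats_def ip_def)
    ultimately show ?thesis by blast
  qed
  moreover have "continuous_on ?S ?f"
  proof -
    have "continuous_on UNIV (\<lambda>\<xi>. J_res m ?X (fst \<xi>, snd \<xi>) t a b)" for t a b
      unfolding J_res_def prod.case
      by (intro continuous_on_sum continuous_on_add continuous_on_mult continuous_on_const
          continuous_on_entry)
    then have "continuous_on UNIV ?f"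
      unfolding stacked_frob_eq_L2_set L2_set_def split_def
      by (intro continuous_on_real_sqrt continuous_on_sum continuous_on_power) simp
    then show ?thesis by (rule continuous_on_subset) simp
  qed
  ultimately obtain \<xi> where \<xi>: "\<xi> \<in> ?S" and min: "\<And>\<zeta>. \<zeta> \<in> ?S \<Longrightarrow> ?f \<xi> \<le> ?f \<zeta>"
    using continuous_attains_inf[of ?S ?f] by blast
  have "?f \<xi> \<noteq> 0"
  proof
    assume "?f \<xi> = 0"
    then have z: "\<forall>t<T. \<forall>a<d. \<forall>b<d. J_res m ?X \<xi> t a b = 0"
      by (simp only: stacked_frob_eq_0_iff)
    obtain V G where [simp]: "\<xi> = (V, G)" by (cases \<xi>)
    \<comment> \<open>\<open>inj_on\<close> compares whole functions, so the entries out of range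
      matter as well. Zero padding of the base point and of the tangent vector makes them
      vanish.\<close>
    have "J_res m ?X \<xi> t a b = 0" for t a b
    proof (cases "t < T \<and> a < d \<and> b < d")
      case False
      then show ?thesis
        using X \<xi> by (auto simp: J_res_def param_space_def tangent_space_def mats_def)
    qed (use z in blast)
    then have "J_res m ?X \<xi> = J_res m ?X (\<lambda>_ _. 0, \<lambda>_ _. 0)"
      by (simp add: J_res_def fun_eq_iff)
    moreover have "(\<lambda>_ _. 0, \<lambda>_ _. 0) \<in> tangent_space d m T ?X"
      by (simp add: tangent_space_def mats_def ip_def)
    ultimately have "\<xi> = (\<lambda>_ _. 0, \<lambda>_ _. 0)"
      using inj \<xi> by (auto dest: inj_onD)
    then show False
      using \<xi> by (simp add: tangent_norm_def vnorm_square frob_square)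
  qed
  then have "0 < ?f \<xi>" using stacked_frob_nonneg[of d T "J_res m ?X \<xi>"] by simp
  also have "?f \<xi> \<le> smallest_singular_value d m T ?X"
    unfolding smallest_singular_value_def using \<xi> min by (intro cInf_greatest) blast+
  finally show ?thesis .
qed

section \<open>Second-order expansion of \<open>Psi\<close> and the local lower bound\<close>

lemma unit_vector_ip_diff:
  assumes "vnorm d u = 1" "vnorm d v = 1"
  shows "ip d u (\<lambda>k. v k - u k) = - (vnorm d (\<lambda>k. v k - u k))\<^sup>2 / 2"
proof -
  have "(vnorm d (\<lambda>k. v k - u k))\<^sup>2 = (\<Sum>k<d. (v k)\<^sup>2 - (u k)\<^sup>2 - 2 * (u k * (v k - u k)))"
    unfolding vnorm_square by (intro sum.cong) (auto simp: power2_eq_square algebra_simps)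
  also have "\<dots> = (vnorm d v)\<^sup>2 - (vnorm d u)\<^sup>2 - 2 * ip d u (\<lambda>k. v k - u k)"
    by (simp add: vnorm_square ip_def sum_subtractf sum_distrib_left)
  finally show ?thesis using assms by simp
qed

text \<open>Pythagoras for the projection onto the orthogonal complement of the unit vector
  \<open>u\<close>.\<close>

lemma vnorm_projection_square:
  assumes "vnorm d u = 1"
  shows "(vnorm d (\<lambda>k. x k - ip d u x * u k))\<^sup>2 = (vnorm d x)\<^sup>2 - (ip d u x)\<^sup>2"
proof -
  define c where "c = ip d u x"
  have "(vnorm d (\<lambda>k. x k - c * u k))\<^sup>2 = (\<Sum>k<d. (x k)\<^sup>2 - 2 * c * (u k * x k) + c\<^sup>2 * (u k)\<^sup>2)"
    unfolding vnorm_square by (intro sum.cong) (auto simp: power2_eq_square algebra_simps)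
  also have "\<dots> = (vnorm d x)\<^sup>2 - 2 * c * ip d u x + c\<^sup>2 * (vnorm d u)\<^sup>2"
    by (simp add: vnorm_square ip_def sum.distrib sum_subtractf sum_distrib_left)
  finally show ?thesis using assms by (simp add: c_def power2_eq_square)
qed

lemma abs_mult_le:
  fixes x y :: "'a::linordered_idom"
  assumes "\<bar>x\<bar> \<le> a" "\<bar>y\<bar> \<le> b"
  shows "\<bar>x * y\<bar> \<le> a * b"
proof -
  have "0 \<le> a" using abs_ge_zero assms(1) by (rule order_trans)
  then show ?thesis unfolding abs_mult using assms by (intro mult_mono) simp_all
qed

text \<open>Here \<open>g\<close>, \<open>e\<close>, \<open>c\<close> stand for
  \<open>\<Gamma> t j\<close>, \<open>G t j\<close>, \<open>c j\<close>, the pair \<open>x\<close>,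
  \<open>y\<close> for entries of the direction error and \<open>p\<close>, \<open>q\<close> for
  entries of \<open>U j\<close>. Each term is at least quadratic in \<open>D\<close>, and
  \<open>D \<le> 1\<close> reduces the cubic one to second order. The four terms contribute
  \<open>B\<close>, 2, 1 and \<open>2 * B\<close>.\<close>

lemma entry_remainder_bound:
  fixes B D g e x y p q c :: real
  assumes "\<bar>g\<bar> \<le> B" "\<bar>e\<bar> \<le> D" "\<bar>x\<bar> \<le> D" "\<bar>y\<bar> \<le> D" "\<bar>p\<bar> \<le> 1" "\<bar>q\<bar> \<le> 1" "\<bar>c\<bar> \<le> D\<^sup>2" "D \<le> 1"
  shows "\<bar>g * (x * y) + e * (x * q + p * y) + e * (x * y) + 2 * (g * (c * (p * q)))\<bar>
    \<le> (3 * B + 3) * D\<^sup>2"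
proof -
  have "\<bar>g * (x * y)\<bar> \<le> B * (D * D)" "\<bar>e * (x * y)\<bar> \<le> 1 * (D * D)"
    using assms by (blast intro: abs_mult_le order_trans)+
  moreover have "\<bar>x * q\<bar> \<le> D * 1" "\<bar>p * y\<bar> \<le> 1 * D" "\<bar>c * (p * q)\<bar> \<le> D\<^sup>2 * (1 * 1)"
    using assms by (blast intro: abs_mult_le)+
  moreover from this have "\<bar>x * q + p * y\<bar> \<le> 2 * D"
    by linarith
  ultimately have "\<bar>g * (x * y)\<bar> \<le> B * D\<^sup>2" "\<bar>e * (x * y)\<bar> \<le> D\<^sup>2"
    "\<bar>e * (x * q + p * y)\<bar> \<le> 2 * D\<^sup>2" "\<bar>g * (c * (p * q))\<bar> \<le> B * D\<^sup>2"
    using abs_mult_le[OF assms(2), of "x * q + p * y" "2 * D"]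
      abs_mult_le[OF assms(1), of "c * (p * q)" "D\<^sup>2"]
    by (simp_all add: power2_eq_square)
  moreover have "(3 * B + 3) * D\<^sup>2 = 3 * (B * D\<^sup>2) + 3 * D\<^sup>2"
    by (simp add: algebra_simps)
  ultimately show ?thesis
    unfolding abs_le_iff by linarith
qed

text \<open>An exact identity, valid for arbitrary \<open>c\<close>. The first three terms are the
  part of the cubic beyond first order; the last undoes the removal of \<open>c j * U j\<close> from
  the direction increment, which both slots of the symmetric product see.\<close>

lemma Psi_remainder_eq:
  fixes U \<Gamma> \<delta> G c
  shows "Psi m (\<lambda>j k. U j k + \<delta> j k, \<lambda>t j. \<Gamma> t j + G t j) t a b - Psi m (U, \<Gamma>) t a b
      - J_res m (U, \<Gamma>) (\<lambda>j k. \<delta> j k - c j * U j k, G) t a b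
    = (\<Sum>j<m. \<Gamma> t j * (\<delta> j a * \<delta> j b) + G t j * (\<delta> j a * U j b + U j a * \<delta> j b)
         + G t j * (\<delta> j a * \<delta> j b) + 2 * (\<Gamma> t j * (c j * (U j a * U j b))))"
  unfolding Psi_def J_res_def prod.case sum_subtractf[symmetric]
  by (intro sum.cong) (auto simp: algebra_simps)

lemma Psi_expansion_lower_bound:
  assumes X: "(U, \<Gamma>) \<in> param_space d m T" and Xh: "(Uh, \<Gamma>h) \<in> param_space d m T"
    and B: "\<And>t j. t < T \<Longrightarrow> j < m \<Longrightarrow> \<bar>\<Gamma> t j\<bar> \<le> B"
    and D: "D = tangent_norm d m T (\<lambda>j k. Uh j k - U j k, \<lambda>t j. \<Gamma>h t j - \<Gamma> t j)" "D \<le> 1"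
    and \<kappa>: "\<kappa> = smallest_singular_value d m T (U, \<Gamma>)" "0 \<le> \<kappa>"
  shows "\<kappa> * (3 / 4 * D) - real (T * (d * d)) * (real m * ((3 * B + 3) * D\<^sup>2))
    \<le> stacked_frob d T (\<lambda>t a b. Psi m (Uh, \<Gamma>h) t a b - Psi m (U, \<Gamma>) t a b)"
proof -
  define \<delta> where "\<delta> = (\<lambda>j k. Uh j k - U j k)"
  define G where "G = (\<lambda>t j. \<Gamma>h t j - \<Gamma> t j)"
  define c where "c = (\<lambda>j. ip d (U j) (\<delta> j))"
  define V where "V = (\<lambda>j k. \<delta> j k - c j * U j k)"
  let ?\<Delta> = "\<lambda>t a b. Psi m (Uh, \<Gamma>h) t a b - Psi m (U, \<Gamma>) t a b"
  let ?R = "\<lambda>t a b. ?\<Delta> t a b - J_res m (U, \<Gamma>) (V, G) t a b"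
  have Dn: "D = tangent_norm d m T (\<delta>, G)" by (simp add: D \<delta>_def G_def)
  have D0: "0 \<le> D" by (simp add: Dn tangent_norm_nonneg)
  have U1: "vnorm d (U j) = 1" "vnorm d (Uh j) = 1" if "j < m" for j
    using X Xh that by (auto simp: param_space_def)
  have \<delta>D: "vnorm d (\<delta> j) \<le> D" if "j < m" for j
    unfolding Dn using that by (rule vnorm_le_tangent_norm)
  have c: "c j = - (vnorm d (\<delta> j))\<^sup>2 / 2" if "j < m" for j
    using unit_vector_ip_diff[OF U1[OF that]] by (simp add: c_def \<delta>_def)
  have sq: "(vnorm d (\<delta> j))\<^sup>2 \<le> D\<^sup>2" if "j < m" for j
    using \<delta>D[OF that] by (intro power_mono vnorm_nonneg)
  have tangent: "(V, G) \<in> tangent_space d m T (U, \<Gamma>)"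
  proof -
    have "ip d (U j) (V j) = ip d (U j) (\<delta> j) - c j * ip d (U j) (U j)" for j
      by (simp add: V_def ip_def sum_subtractf sum_distrib_left algebra_simps)
    moreover have "V \<in> mats m d" "G \<in> mats T m"
      using X Xh by (auto simp: V_def G_def \<delta>_def mats_def param_space_def)
    ultimately show ?thesis using U1 by (simp add: tangent_space_def c_def vnorm_square_ip[symmetric])
  qed
  \<comment> \<open>Projection costs \<open>c j\<close> squared, which is a quarter of the fourth
    power of the error norm. As that norm is at most 1, at least 3/4 of its square survives, hence
    at least 9/16, the square of 3/4. The component \<open>G\<close> is untouched.\<close>
  have "3 / 4 * D \<le> tangent_norm d m T (V, G)"
  proof (rule power2_le_imp_le)
    have "9 / 16 * (vnorm d (\<delta> j))\<^sup>2 \<le> (vnorm d (V j))\<^sup>2" if "j < m" for j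
    proof -
      have "(vnorm d (\<delta> j))\<^sup>2 \<le> 1"
        using sq[OF that] power_le_one[OF D0 D(2), of 2] by linarith
      then have "(vnorm d (\<delta> j))\<^sup>2 * (vnorm d (\<delta> j))\<^sup>2 \<le> (vnorm d (\<delta> j))\<^sup>2 * 1"
        by (intro mult_left_mono) auto
      moreover have "(vnorm d (V j))\<^sup>2 = (vnorm d (\<delta> j))\<^sup>2 - (c j)\<^sup>2"
        using vnorm_projection_square[OF U1(1)[OF that], of "\<delta> j"] by (simp add: V_def c_def)
      moreover have "(c j)\<^sup>2 = (vnorm d (\<delta> j))\<^sup>2 * (vnorm d (\<delta> j))\<^sup>2 / 4"
        by (simp add: c[OF that] power2_eq_square)
      moreover have "0 \<le> (vnorm d (\<delta> j))\<^sup>2" by simp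
      ultimately show ?thesis by linarith
    qed
    then have "9 / 16 * (\<Sum>j<m. (vnorm d (\<delta> j))\<^sup>2) \<le> (\<Sum>j<m. (vnorm d (V j))\<^sup>2)"
      unfolding sum_distrib_left by (intro sum_mono) auto
    then have "9 / 16 * D\<^sup>2 \<le> (tangent_norm d m T (V, G))\<^sup>2"
      unfolding Dn tangent_norm_square distrib_left using zero_le_power2[of "frob T m G"]
      by linarith
    then show "(3 / 4 * D)\<^sup>2 \<le> (tangent_norm d m T (V, G))\<^sup>2"
      by (simp add: power2_eq_square)
  qed (rule tangent_norm_nonneg)
  then have "\<kappa> * (3 / 4 * D) \<le> \<kappa> * tangent_norm d m T (V, G)"
    using \<kappa>(2) by (rule mult_left_mono)
  also have "\<dots> \<le> stacked_frob d T (J_res m (U, \<Gamma>) (V, G))"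
    unfolding \<kappa>(1) using tangent by (rule smallest_singular_value_le)
  \<comment> \<open>The differential at \<open>(V, G)\<close> equals \<open>?\<Delta>\<close> minus
    \<open>?R\<close>.\<close>
  also have "\<dots> \<le> stacked_frob d T ?\<Delta> + stacked_frob d T ?R"
    using stacked_frob_triangle_diff[of d T ?\<Delta> ?R] by simp
  finally have main: "\<kappa> * (3 / 4 * D) \<le> stacked_frob d T ?\<Delta> + stacked_frob d T ?R" .
  have "\<bar>?R t a b\<bar> \<le> real m * ((3 * B + 3) * D\<^sup>2)" if tab: "t < T" "a < d" "b < d" for t a b
  proof -
    have R: "?R t a b = (\<Sum>j<m. \<Gamma> t j * (\<delta> j a * \<delta> j b) + G t j * (\<delta> j a * U j b + U j a * \<delta> j b)
         + G t j * (\<delta> j a * \<delta> j b) + 2 * (\<Gamma> t j * (c j * (U j a * U j b))))"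
      using Psi_remainder_eq[of m U \<delta> \<Gamma> G t a b c] by (simp add: \<delta>_def G_def V_def)
    have "\<bar>?R t a b\<bar> \<le> (\<Sum>j<m. (3 * B + 3) * D\<^sup>2)"
      unfolding R
    proof (rule order_trans[OF sum_abs], rule sum_mono)
      fix j assume "j \<in> {..<m}"
      then have j: "j < m" by simp
      have "\<bar>\<Gamma> t j\<bar> \<le> B" using B tab(1) j .
      moreover have "\<bar>G t j\<bar> \<le> D"
        unfolding Dn using tab(1) j by (rule abs_le_tangent_norm)
      moreover have "\<bar>\<delta> j a\<bar> \<le> D" "\<bar>\<delta> j b\<bar> \<le> D"
        using abs_le_vnorm[of _ d "\<delta> j"] tab \<delta>D[OF j] by (meson order_trans)+
      moreover have "\<bar>U j a\<bar> \<le> 1" "\<bar>U j b\<bar> \<le> 1"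
        using abs_le_vnorm[of _ d "U j"] tab U1(1)[OF j] by auto
      moreover have "\<bar>c j\<bar> \<le> D\<^sup>2"
        unfolding c[OF j] using sq[OF j] zero_le_power2[of "vnorm d (\<delta> j)"]
        by (simp only: abs_le_iff) linarith
      ultimately show "\<bar>\<Gamma> t j * (\<delta> j a * \<delta> j b) + G t j * (\<delta> j a * U j b + U j a * \<delta> j b)
          + G t j * (\<delta> j a * \<delta> j b) + 2 * (\<Gamma> t j * (c j * (U j a * U j b)))\<bar> \<le> (3 * B + 3) * D\<^sup>2"
        using D(2) by (rule entry_remainder_bound)
    qed
    then show ?thesis
      by (simp only: sum_constant card_lessThan)
  qed
  then have "stacked_frob d T ?R \<le> real (T * (d * d)) * (real m * ((3 * B + 3) * D\<^sup>2))"
    by (rule stacked_frob_le)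
  with main show ?thesis by linarith
qed

text \<open>Within the radius chosen below the quadratic remainder costs at most
  \<open>\<kappa> / 4 * D\<close>, so \<open>\<kappa> / 2 * D\<close> is left of the linear term.
  The radius depends on the dimensions, on \<open>\<Gamma>\<close> and on \<open>\<kappa>\<close>,
  whereas the factor 1/2 is universal; this keeps the final constant uniform.\<close>

lemma Psi_local_lower_bound:
  assumes X: "(U, \<Gamma>) \<in> param_space d m T"
    and \<kappa>: "\<kappa> = smallest_singular_value d m T (U, \<Gamma>)" "0 < \<kappa>"
  obtains r where "0 < r" "\<And>Uh \<Gamma>h. (Uh, \<Gamma>h) \<in> param_space d m T \<Longrightarrow>
      tangent_norm d m T (\<lambda>j k. Uh j k - U j k, \<lambda>t j. \<Gamma>h t j - \<Gamma> t j) < r \<Longrightarrow>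
      \<kappa> / 2 * tangent_norm d m T (\<lambda>j k. Uh j k - U j k, \<lambda>t j. \<Gamma>h t j - \<Gamma> t j)
        \<le> stacked_frob d T (\<lambda>t a b. Psi m (Uh, \<Gamma>h) t a b - Psi m (U, \<Gamma>) t a b)"
proof -
  define B where "B = tangent_norm d m T (U, \<Gamma>)"
  have B: "\<bar>\<Gamma> t j\<bar> \<le> B" if "t < T" "j < m" for t j
    unfolding B_def using that by (rule abs_le_tangent_norm)
  have B0: "0 \<le> B" by (simp add: B_def tangent_norm_nonneg)
  \<comment> \<open>The summand 1 only ensures that \<open>K\<close> is positive, so that it can be
    divided by.\<close>
  define K where "K = real (T * (d * d)) * (real m * (3 * B + 3)) + 1"
  have K: "0 < K" unfolding K_def using B0 by (intro add_nonneg_pos mult_nonneg_nonneg) auto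
  show ?thesis
  proof (rule that[of "min 1 (\<kappa> / (4 * K))"])
    show "0 < min 1 (\<kappa> / (4 * K))" using K \<kappa> by simp
  next
    fix Uh \<Gamma>h
    define D where "D = tangent_norm d m T (\<lambda>j k. Uh j k - U j k, \<lambda>t j. \<Gamma>h t j - \<Gamma> t j)"
    assume Xh: "(Uh, \<Gamma>h) \<in> param_space d m T"
      and "tangent_norm d m T (\<lambda>j k. Uh j k - U j k, \<lambda>t j. \<Gamma>h t j - \<Gamma> t j) < min 1 (\<kappa> / (4 * K))"
    then have D1: "D \<le> 1" and "D < \<kappa> / (4 * K)" by (simp_all add: D_def)
    then have KD: "K * D \<le> \<kappa> / 4" using K by (simp add: field_simps)
    have D0: "0 \<le> D" by (simp add: D_def tangent_norm_nonneg)
    have "real (T * (d * d)) * (real m * ((3 * B + 3) * D\<^sup>2)) = (K - 1) * D\<^sup>2"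
      by (simp add: K_def)
    also have "\<dots> \<le> K * D\<^sup>2" by (intro mult_right_mono) auto
    also have "\<dots> = K * D * D" by (simp add: power2_eq_square)
    also have "\<dots> \<le> \<kappa> / 4 * D" using KD D0 by (rule mult_right_mono)
    finally have "real (T * (d * d)) * (real m * ((3 * B + 3) * D\<^sup>2)) \<le> \<kappa> / 4 * D" .
    then show "\<kappa> / 2 * tangent_norm d m T (\<lambda>j k. Uh j k - U j k, \<lambda>t j. \<Gamma>h t j - \<Gamma> t j)
        \<le> stacked_frob d T (\<lambda>t a b. Psi m (Uh, \<Gamma>h) t a b - Psi m (U, \<Gamma>) t a b)"
      using Psi_expansion_lower_bound[OF X Xh B D_def D1 \<kappa>(1) less_imp_le[OF \<kappa>(2)]]
      unfolding D_def[symmetric] by (simp add: algebra_simps)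
  qed
qed

section \<open>From the norm of the error to the factor distance and the recovery score\<close>

lemma dist_pm_pi_le:
  "dist_pm_pi d m T (Uh, \<Gamma>h) (U, \<Gamma>)
    \<le> tangent_norm d m T (\<lambda>j k. Uh j k - U j k, \<lambda>t j. \<Gamma>h t j - \<Gamma> t j)"
proof -
  let ?F = "\<lambda>(\<pi>, \<sigma>). (\<Sum>j<m. (vnorm d (\<lambda>k. Uh (\<pi> j) k - \<sigma> j * U j k))\<^sup>2) +
      (\<Sum>j<m. (vnorm T (\<lambda>t. \<Gamma>h t (\<pi> j) - \<Gamma> t j))\<^sup>2)"
  let ?P = "{\<pi>. \<pi> permutes {..<m}} \<times> ({..<m} \<rightarrow>\<^sub>E {-1, 1 :: real})"
  \<comment> \<open>The signs range over an extensional function space, so the trivial choice has to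
    be restricted to the index range.\<close>
  let ?\<sigma> = "\<lambda>j\<in>{..<m}. 1 :: real"
  have "finite ?P"
    by (intro finite_cartesian_product finite_permutations finite_PiE) auto
  moreover have "(id, ?\<sigma>) \<in> ?P"
    by (auto simp: permutes_id)
  ultimately have "Min (?F ` ?P) \<le> ?F (id, ?\<sigma>)"
    by (intro Min_le finite_imageI imageI)
  also have "\<dots> = (\<Sum>j<m. (vnorm d (\<lambda>k. Uh j k - U j k))\<^sup>2) + (\<Sum>j<m. \<Sum>t<T. (\<Gamma>h t j - \<Gamma> t j)\<^sup>2)"
    by (simp add: vnorm_square)
  also have "(\<Sum>j<m. \<Sum>t<T. (\<Gamma>h t j - \<Gamma> t j)\<^sup>2) = (frob T m (\<lambda>t j. \<Gamma>h t j - \<Gamma> t j))\<^sup>2"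
    unfolding frob_square by (rule sum.swap)
  finally show ?thesis
    unfolding dist_pm_pi_def tangent_norm_def prod.case by (rule real_sqrt_le_mono)
qed

text \<open>The identity permutation bounds the maximum from below. Averaging the losses over
  \<open>m\<close> directions only helps, so their sum can replace the mean. The weight part
  \<open>G\<close> is free, since adding its norm weakens the bound.\<close>

lemma DirRec_ge:
  assumes m: "1 \<le> m" and X: "(U, \<Gamma>) \<in> param_space d m T" and Xh: "(Uh, \<Gamma>h) \<in> param_space d m T"
  shows "1 - (tangent_norm d m T (\<lambda>j k. Uh j k - U j k, G))\<^sup>2 / 2 \<le> DirRec d m Uh U"
proof -
  let ?F = "\<lambda>\<pi>. 1 / real m * (\<Sum>j<m. \<bar>ip d (Uh (\<pi> j)) (U j)\<bar>)"
  let ?s = "\<Sum>j<m. (vnorm d (\<lambda>k. Uh j k - U j k))\<^sup>2"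
  have s: "0 \<le> ?s" by (simp add: sum_nonneg)
  have "1 - (vnorm d (\<lambda>k. Uh j k - U j k))\<^sup>2 / 2 \<le> \<bar>ip d (Uh j) (U j)\<bar>" if "j < m" for j
  proof -
    have u: "vnorm d (U j) = 1" and uh: "vnorm d (Uh j) = 1"
      using X Xh that by (auto simp: param_space_def)
    have "ip d (Uh j) (U j) = (vnorm d (U j))\<^sup>2 + ip d (U j) (\<lambda>k. Uh j k - U j k)"
      by (simp add: vnorm_square_ip ip_def sum.distrib[symmetric] algebra_simps)
    then show ?thesis using unit_vector_ip_diff[OF u uh] u by simp
  qed
  then have "(\<Sum>j<m. 1 - (vnorm d (\<lambda>k. Uh j k - U j k))\<^sup>2 / 2) \<le> (\<Sum>j<m. \<bar>ip d (Uh j) (U j)\<bar>)"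
    by (intro sum_mono) auto
  then have "real m - ?s / 2 \<le> (\<Sum>j<m. \<bar>ip d (Uh j) (U j)\<bar>)"
    by (simp add: sum_subtractf sum_divide_distrib)
  then have "1 / real m * (real m - ?s / 2) \<le> ?F id"
    by (intro mult_left_mono) auto
  then have "1 - ?s / 2 / real m \<le> ?F id"
    using m by (simp add: right_diff_distrib)
  moreover have "?s / 2 / real m \<le> ?s / 2"
    using m s by (simp add: divide_le_eq mult_le_cancel_left1)
  moreover have "?s \<le> (tangent_norm d m T (\<lambda>j k. Uh j k - U j k, G))\<^sup>2"
    unfolding tangent_norm_square by simp
  moreover have "?F id \<le> DirRec d m Uh U"
    unfolding DirRec_def
    by (intro Max_ge finite_imageI imageI) (simp_all add: permutes_id finite_permutations del: id_apply)
  ultimately show ?thesis by linarith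
qed

section \<open>Assembly of the recovery bounds\<close>

theorem proposition2:
  shows "\<forall>C\<^sub>0 > (0::real). \<exists>C > (0::real).
    \<forall>(d::nat) (m::nat) (T::nat) (U :: nat \<Rightarrow> nat \<Rightarrow> real) (\<Gamma> :: nat \<Rightarrow> nat \<Rightarrow> real).
      1 \<le> d \<longrightarrow> 1 \<le> m \<longrightarrow> 1 \<le> T \<longrightarrow>
      (U, \<Gamma>) \<in> param_space d m T \<longrightarrow>
      inj_on (J_res m (U, \<Gamma>)) (tangent_space d m T (U, \<Gamma>)) \<longrightarrow>
      (let \<kappa> = smallest_singular_value d m T (U, \<Gamma>) in
       \<exists>N \<eta>\<^sub>0. openin (top_of_set (param_space d m T)) N \<and> (U, \<Gamma>) \<in> N \<and> (0::real) < \<eta>\<^sub>0 \<and>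
        (\<forall>(E :: nat \<Rightarrow> nat \<Rightarrow> nat \<Rightarrow> real) Uh \<Gamma>h.
          (\<forall>t<T. \<forall>a<d. \<forall>b<d. E t a b = E t b a) \<longrightarrow>
          (let \<eta> = stacked_frob d T E;
               Hh = (\<lambda>t a b. Psi m (U, \<Gamma>) t a b + E t a b)
           in \<eta> \<le> \<eta>\<^sub>0 \<longrightarrow>
              (Uh, \<Gamma>h) \<in> N \<longrightarrow>
              local_minimizer_on (param_space d m T) (objective d m T Hh) (Uh, \<Gamma>h) \<longrightarrow>
              stacked_frob d T (residual m Hh (Uh, \<Gamma>h)) \<le> C\<^sub>0 * \<eta> \<longrightarrow>
              dist_pm_pi d m T (Uh, \<Gamma>h) (U, \<Gamma>) \<le> C * \<eta> / \<kappa> \<and>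
              DirRec d m Uh U \<ge> 1 - C * \<eta>\<^sup>2 / \<kappa>\<^sup>2)))"
proof (intro allI impI)
  fix C\<^sub>0 :: real
  assume C\<^sub>0: "0 < C\<^sub>0"
  \<comment> \<open>One constant for both claims: the distance needs
    \<open>2 * (C\<^sub>0 + 1)\<close>, while half the square of that is exactly \<open>C\<close>,
    as the recovery score needs.\<close>
  define C where "C = 2 * (C\<^sub>0 + 1)\<^sup>2"
  have C: "0 < C" using C\<^sub>0 by (simp add: C_def)
  have C': "2 * (C\<^sub>0 + 1) \<le> C"
    using C\<^sub>0 by (simp add: C_def power2_eq_square algebra_simps)
  show "\<exists>C > (0::real).
    \<forall>(d::nat) (m::nat) (T::nat) (U :: nat \<Rightarrow> nat \<Rightarrow> real) (\<Gamma> :: nat \<Rightarrow> nat \<Rightarrow> real).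
      1 \<le> d \<longrightarrow> 1 \<le> m \<longrightarrow> 1 \<le> T \<longrightarrow>
      (U, \<Gamma>) \<in> param_space d m T \<longrightarrow>
      inj_on (J_res m (U, \<Gamma>)) (tangent_space d m T (U, \<Gamma>)) \<longrightarrow>
      (let \<kappa> = smallest_singular_value d m T (U, \<Gamma>) in
       \<exists>N \<eta>\<^sub>0. openin (top_of_set (param_space d m T)) N \<and> (U, \<Gamma>) \<in> N \<and> (0::real) < \<eta>\<^sub>0 \<and>
        (\<forall>(E :: nat \<Rightarrow> nat \<Rightarrow> nat \<Rightarrow> real) Uh \<Gamma>h.
          (\<forall>t<T. \<forall>a<d. \<forall>b<d. E t a b = E t b a) \<longrightarrow>
          (let \<eta> = stacked_frob d T E;
               Hh = (\<lambda>t a b. Psi m (U, \<Gamma>) t a b + E t a b)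
           in \<eta> \<le> \<eta>\<^sub>0 \<longrightarrow>
              (Uh, \<Gamma>h) \<in> N \<longrightarrow>
              local_minimizer_on (param_space d m T) (objective d m T Hh) (Uh, \<Gamma>h) \<longrightarrow>
              stacked_frob d T (residual m Hh (Uh, \<Gamma>h)) \<le> C\<^sub>0 * \<eta> \<longrightarrow>
              dist_pm_pi d m T (Uh, \<Gamma>h) (U, \<Gamma>) \<le> C * \<eta> / \<kappa> \<and>
              DirRec d m Uh U \<ge> 1 - C * \<eta>\<^sup>2 / \<kappa>\<^sup>2)))"
  proof (intro exI[of _ C] conjI C allI impI)
    fix d m T :: nat and U \<Gamma> :: rmat
    assume "1 \<le> d" and m: "1 \<le> m" and T: "1 \<le> T" and X: "(U, \<Gamma>) \<in> param_space d m T"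
      and inj: "inj_on (J_res m (U, \<Gamma>)) (tangent_space d m T (U, \<Gamma>))"
    define \<kappa> where "\<kappa> = smallest_singular_value d m T (U, \<Gamma>)"
    have \<kappa>: "0 < \<kappa>"
      unfolding \<kappa>_def using m T X inj by (rule smallest_singular_value_pos)
    let ?D = "\<lambda>Uh \<Gamma>h. tangent_norm d m T (\<lambda>j k. Uh j k - U j k, \<lambda>t j. \<Gamma>h t j - \<Gamma> t j)"
    obtain r where r: "0 < r" and lower: "\<And>Uh \<Gamma>h. (Uh, \<Gamma>h) \<in> param_space d m T \<Longrightarrow> ?D Uh \<Gamma>h < r \<Longrightarrow>
        \<kappa> / 2 * ?D Uh \<Gamma>h \<le> stacked_frob d T (\<lambda>t a b. Psi m (Uh, \<Gamma>h) t a b - Psi m (U, \<Gamma>) t a b)"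
      using Psi_local_lower_bound[OF X \<kappa>_def \<kappa>] by blast
    \<comment> \<open>An open norm ball around the truth, of a radius fixed before the noise and the
      estimate are given.\<close>
    define N where "N = param_space d m T \<inter> {Y. ?D (fst Y) (snd Y) < r}"
    have "open {Y :: factors. ?D (fst Y) (snd Y) < r}"
      by (intro open_Collect_less continuous_on_tangent_norm_diff continuous_on_const)
    then have "openin (top_of_set (param_space d m T)) N"
      unfolding N_def by (rule openin_open_Int)
    moreover have "(U, \<Gamma>) \<in> N"
      using X r by (simp add: N_def tangent_norm_def vnorm_square frob_square)
    moreover have "dist_pm_pi d m T (Uh, \<Gamma>h) (U, \<Gamma>) \<le> C * stacked_frob d T E / \<kappa> \<and>
        1 - C * (stacked_frob d T E)\<^sup>2 / \<kappa>\<^sup>2 \<le> DirRec d m Uh U"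
      if YN: "(Uh, \<Gamma>h) \<in> N"
        and res: "stacked_frob d T (residual m (\<lambda>t a b. Psi m (U, \<Gamma>) t a b + E t a b) (Uh, \<Gamma>h))
          \<le> C\<^sub>0 * stacked_frob d T E" for E Uh \<Gamma>h
    proof -
      define \<eta> where "\<eta> = stacked_frob d T E"
      define D where "D = ?D Uh \<Gamma>h"
      have \<eta>: "0 \<le> \<eta>" by (simp add: \<eta>_def stacked_frob_nonneg)
      have D: "0 \<le> D" by (simp add: D_def tangent_norm_nonneg)
      have Xh: "(Uh, \<Gamma>h) \<in> param_space d m T" and "D < r"
        using YN by (auto simp: N_def D_def)
      then have "\<kappa> / 2 * D \<le> stacked_frob d T (\<lambda>t a b. Psi m (Uh, \<Gamma>h) t a b - Psi m (U, \<Gamma>) t a b)"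
        unfolding D_def by (rule lower)
      \<comment> \<open>The change of \<open>Psi\<close> from the truth to the estimate is
        \<open>E\<close> minus the residual.\<close>
      also have "\<dots> \<le> stacked_frob d T E
          + stacked_frob d T (residual m (\<lambda>t a b. Psi m (U, \<Gamma>) t a b + E t a b) (Uh, \<Gamma>h))"
        using stacked_frob_triangle_diff[of d T E
            "residual m (\<lambda>t a b. Psi m (U, \<Gamma>) t a b + E t a b) (Uh, \<Gamma>h)"]
        by (simp add: residual_def)
      also have "\<dots> \<le> (C\<^sub>0 + 1) * \<eta>"
        using res by (simp add: \<eta>_def algebra_simps)
      finally have bound: "D \<le> 2 * (C\<^sub>0 + 1) * \<eta> / \<kappa>"
        using \<kappa> by (simp add: field_simps)
      have "dist_pm_pi d m T (Uh, \<Gamma>h) (U, \<Gamma>) \<le> D"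
        unfolding D_def by (rule dist_pm_pi_le)
      also note bound
      also have "2 * (C\<^sub>0 + 1) * \<eta> / \<kappa> \<le> C * \<eta> / \<kappa>"
        using C' \<eta> \<kappa> by (intro divide_right_mono mult_right_mono) auto
      finally have dist: "dist_pm_pi d m T (Uh, \<Gamma>h) (U, \<Gamma>) \<le> C * \<eta> / \<kappa>" .
      have "D\<^sup>2 \<le> (2 * (C\<^sub>0 + 1) * \<eta> / \<kappa>)\<^sup>2"
        using bound D by (rule power_mono)
      also have "\<dots> = 2 * (C * \<eta>\<^sup>2 / \<kappa>\<^sup>2)"
        unfolding C_def power_mult_distrib power_divide by simp
      finally have "1 - C * \<eta>\<^sup>2 / \<kappa>\<^sup>2 \<le> 1 - D\<^sup>2 / 2" by linarith
      also have "\<dots> \<le> DirRec d m Uh U"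
        unfolding D_def using m X Xh by (rule DirRec_ge)
      finally show ?thesis using dist unfolding \<eta>_def by simp
    qed
    ultimately show "let \<kappa> = smallest_singular_value d m T (U, \<Gamma>) in
       \<exists>N \<eta>\<^sub>0. openin (top_of_set (param_space d m T)) N \<and> (U, \<Gamma>) \<in> N \<and> (0::real) < \<eta>\<^sub>0 \<and>
        (\<forall>(E :: nat \<Rightarrow> nat \<Rightarrow> nat \<Rightarrow> real) Uh \<Gamma>h.
          (\<forall>t<T. \<forall>a<d. \<forall>b<d. E t a b = E t b a) \<longrightarrow>
          (let \<eta> = stacked_frob d T E;
               Hh = (\<lambda>t a b. Psi m (U, \<Gamma>) t a b + E t a b)
           in \<eta> \<le> \<eta>\<^sub>0 \<longrightarrow>
              (Uh, \<Gamma>h) \<in> N \<longrightarrow>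
              local_minimizer_on (param_space d m T) (objective d m T Hh) (Uh, \<Gamma>h) \<longrightarrow>
              stacked_frob d T (residual m Hh (Uh, \<Gamma>h)) \<le> C\<^sub>0 * \<eta> \<longrightarrow>
              dist_pm_pi d m T (Uh, \<Gamma>h) (U, \<Gamma>) \<le> C * \<eta> / \<kappa> \<and>
              DirRec d m Uh U \<ge> 1 - C * \<eta>\<^sup>2 / \<kappa>\<^sup>2))"
      unfolding Let_def \<kappa>_def[symmetric]
      by (intro exI[of _ N] exI[of _ "1::real"]) auto
  qed
qed

end
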